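(* Let $n\ge 4$ and $s$ be integers with $2 \leq s \leq \lfloor\frac{n}{2}\rfloor$, and let $S_{n,s}$ be the spire graph. Then $$rn(S_{n,s}) \leq \begin{cases} 2k^2 -4k + 2s +3 & \text{if } n = 2k \text{ and } 2 \leq s \leq k-2,\\ 2k^2 -2k & \text{if } n = 2k \text{ and } s= k-1,\\ 2k^2 -2k + 1 & \text{if } n = 2k \text{ and } s= k,\\ 2k^2 -2k + 2s & \text{if } n = 2k + 1. \end{cases}$$
   Context: For a connected graph $G$, $d(u,v)$ denotes the graph distance and $\mathrm{diam}(G)$ the diameter. A radio labeling of $G$ is a function $c:V(G)\to\mathbb{Z}_{+}$ (positive integers; $0$ is not allowed) such that for all distinct $u,v\in V(G)$, $d(u,v)+|c(u)-c(v)|\ge \mathrm{diam}(G)+1$. The span of $c$ is the maximum value of $c$, and the radio number $rn(G)$ is the minimum span over all radio labelings of $G$. For integers $n\ge 4$ and $2\le s\le n-2$, the spire graph $S_{n,s}$ has vertices $v_1,\dots,v_n$ and edges $\{v_i,v_{i+1}\}$ for $i=1,\dots,n-2$ together with the edge $\{v_s,v_n\}$. *)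

theory Defs
  imports Main
begin

text \<open>A graph is given by a vertex set \<open>V\<close> and a set \<open>E\<close> of two-element subsets of \<open>V\<close>.\<close>

definition adj_rel :: "'a set set \<Rightarrow> 'a rel" where
  "adj_rel E = {(u, v). {u, v} \<in> E}"

text \<open>\<open>adj_rel E ^^ k\<close> relates the endpoints of walks with \<open>k\<close> edges. The value is only
  meaningful for \<open>u\<close>, \<open>v\<close> in the same connected component.\<close>

definition graph_dist :: "'a set set \<Rightarrow> 'a \<Rightarrow> 'a \<Rightarrow> nat" where
  "graph_dist E u v = (LEAST k. (u, v) \<in> adj_rel E ^^ k)"

definition diam :: "'a set \<Rightarrow> 'a set set \<Rightarrow> nat" where
  "diam V E = Max {graph_dist E u v | u v. u \<in> V \<and> v \<in> V}"

text \<open>Only the values of the labeling on \<open>V\<close> matter.\<close>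

definition radio_labeling :: "'a set \<Rightarrow> 'a set set \<Rightarrow> ('a \<Rightarrow> nat) \<Rightarrow> bool" where
  "radio_labeling V E c \<longleftrightarrow>
     (\<forall>v\<in>V. c v > 0) \<and>
     (\<forall>u\<in>V. \<forall>v\<in>V. u \<noteq> v \<longrightarrow>
        int (graph_dist E u v) + \<bar>int (c u) - int (c v)\<bar> \<ge> int (diam V E) + 1)"

definition label_span :: "'a set \<Rightarrow> ('a \<Rightarrow> nat) \<Rightarrow> nat" where
  "label_span V c = Max (c ` V)"

definition radio_number :: "'a set \<Rightarrow> 'a set set \<Rightarrow> nat" where
  "radio_number V E = (LEAST m. \<exists>c. radio_labeling V E c \<and> label_span V c = m)"

text \<open>The spire graph: the vertex \<open>v\<^sub>i\<close> is represented by its index \<open>i\<close>.\<close>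

definition spire_verts :: "nat \<Rightarrow> nat set" where
  "spire_verts n = {1..n}"

definition spire_edges :: "nat \<Rightarrow> nat \<Rightarrow> nat set set" where
  "spire_edges n s = {{i, i + 1} | i. 1 \<le> i \<and> i \<le> n - 2} \<union> {{s, n}}"

definition rn_spire :: "nat \<Rightarrow> nat \<Rightarrow> nat" where
  "rn_spire n s = radio_number (spire_verts n) (spire_edges n s)"

end

theory Submission
  imports Defs
begin

text \<open>The diameter is \<open>n - 2\<close>. List the vertices in an order that alternates between the two halves
  of the path and let consecutive labels differ by \<open>n - 1\<close> minus the distance of their vertices
  (plus one in a few places). Large consecutive distances give a small span, while alternating far
  and near vertices keeps the condition for vertices two apart in the order.

  In the orders given below, \<open>l\<^sub>j\<close> and \<open>r\<^sub>j\<close> are the path vertices \<open>k - j\<close> and \<open>k + j\<close> for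
  \<open>n = 2k\<close> (so \<open>l\<^sub>0 = r\<^sub>0\<close>), respectively \<open>k - j\<close> and \<open>k + 1 + j\<close> for \<open>n = 2k + 1\<close>; the tip is the
  vertex \<open>n\<close>. In all four cases the labels of the repeated blocks of two vertices grow by \<open>2k - 1\<close>
  per block.\<close>

section \<open>Walks and distances in arbitrary graphs\<close>

lemma relpow_sym:
  assumes "sym R" and "(x, y) \<in> R ^^ k"
  shows "(y, x) \<in> R ^^ k"
  using assms(2)
proof (induction k arbitrary: y)
  case (Suc k)
  then obtain z where "(x, z) \<in> R ^^ k" and "(z, y) \<in> R"
    by auto
  then show ?case
    using Suc.IH assms(1) by (meson relpow_Suc_I2 symD)
qed auto

lemma sym_adj_rel: "sym (adj_rel E)"
  by (auto simp: sym_def adj_rel_def insert_commute)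

lemma graph_dist_commute: "graph_dist E u v = graph_dist E v u"
proof -
  have "(u, v) \<in> adj_rel E ^^ k \<longleftrightarrow> (v, u) \<in> adj_rel E ^^ k" for k
    by (blast intro: relpow_sym[OF sym_adj_rel])
  then show ?thesis
    by (simp add: graph_dist_def)
qed

lemma graph_dist_refl [simp]: "graph_dist E u u = 0"
  by (simp add: graph_dist_def)

lemma walk_potential_le:
  fixes f :: "'a \<Rightarrow> int"
  assumes "\<And>x y. {x, y} \<in> E \<Longrightarrow> \<bar>f x - f y\<bar> \<le> 1" and "(u, v) \<in> adj_rel E ^^ k"
  shows "\<bar>f u - f v\<bar> \<le> int k"
  using assms(2)
proof (induction k arbitrary: v)
  case (Suc k)
  then obtain z where "(u, z) \<in> adj_rel E ^^ k" and "(z, v) \<in> adj_rel E"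
    by auto
  with Suc.IH assms(1)[of z v] show ?case
    by (fastforce simp: adj_rel_def)
qed auto

text \<open>\<open>f\<close> changes by at most one along an edge, so no walk is shorter than the
  potential difference, and a walk attaining it is shortest.\<close>

lemma graph_dist_eq_potential:
  fixes f :: "'a \<Rightarrow> int"
  assumes "\<And>x y. {x, y} \<in> E \<Longrightarrow> \<bar>f x - f y\<bar> \<le> 1" and "(u, v) \<in> adj_rel E ^^ k"
    and "\<bar>f u - f v\<bar> = int k"
  shows "graph_dist E u v = k"
  unfolding graph_dist_def
proof (rule Least_equality)
  show "k \<le> j" if "(u, v) \<in> adj_rel E ^^ j" for j
    using walk_potential_le[of E f, OF assms(1) that] assms(3) by simp
qed fact

section \<open>Distances and diameter of the spire graph\<close>

lemma spire_path_walk: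
  assumes "1 \<le> u" "u \<le> v" "v < n"
  shows "(u, v) \<in> adj_rel (spire_edges n s) ^^ (v - u)"
  using assms(2,3)
proof (induction v rule: dec_induct)
  case (step v)
  then have "(v, Suc v) \<in> adj_rel (spire_edges n s)"
    using assms(1) unfolding adj_rel_def spire_edges_def by fastforce
  with step show ?case
    by (auto simp: Suc_diff_le)
qed auto

lemma spire_dist_path:
  assumes "1 \<le> u" "u \<le> v" "v < n" "s < n"
  shows "graph_dist (spire_edges n s) u v = v - u"
\<comment> \<open>The potential is the position along the path, with the tip retracted onto
  \<open>s\<close>.\<close>
proof (rule graph_dist_eq_potential[where f = "\<lambda>x. if x = n then int s else int x"])
  show "\<bar>(if x = n then int s else int x) - (if y = n then int s else int y)\<bar> \<le> 1"
    if "{x, y} \<in> spire_edges n s" for x y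
    using that assms by (auto simp: spire_edges_def doubleton_eq_iff)
qed (use assms spire_path_walk in auto)

lemma spire_dist_tip:
  assumes "1 \<le> u" "u < n" "1 \<le> s" "s < n"
  shows "int (graph_dist (spire_edges n s) u n) = \<bar>int s - int u\<bar> + 1"
proof -
  have "(u, s) \<in> adj_rel (spire_edges n s) ^^ nat \<bar>int s - int u\<bar>"
  proof (cases "u \<le> s")
    case True
    then show ?thesis
      using spire_path_walk[of u s n s] assms by (simp add: nat_diff_distrib)
  next
    case False
    then show ?thesis
      using relpow_sym[OF sym_adj_rel spire_path_walk[of s u n s]] assms
      by (simp add: nat_diff_distrib)
  qed
  moreover have "(s, n) \<in> adj_rel (spire_edges n s)"
    by (simp add: adj_rel_def spire_edges_def)
  ultimately have walk: "(u, n) \<in> adj_rel (spire_edges n s) ^^ Suc (nat \<bar>int s - int u\<bar>)"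
    by auto
  have "graph_dist (spire_edges n s) u n = Suc (nat \<bar>int s - int u\<bar>)"
  \<comment> \<open>Here the potential is the distance to the tip itself.\<close>
  proof (rule graph_dist_eq_potential[where f = "\<lambda>x. if x = n then 0 else \<bar>int s - int x\<bar> + 1"])
    show "\<bar>(if x = n then 0 else \<bar>int s - int x\<bar> + 1) - (if y = n then 0 else \<bar>int s - int y\<bar> + 1)\<bar> \<le> 1"
      if "{x, y} \<in> spire_edges n s" for x y
      using that assms by (auto simp: spire_edges_def doubleton_eq_iff)
  qed (use assms walk in auto)
  then show ?thesis
    by simp
qed

lemma spire_diam_le:
  assumes "2 \<le> s" "s \<le> n - 2"
  shows "diam (spire_verts n) (spire_edges n s) \<le> n - 2"
proof -
  let ?d = "graph_dist (spire_edges n s)"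
  have ordered: "?d u v \<le> n - 2" if "1 \<le> u" "u < v" "v \<le> n" for u v
  proof (cases "v = n")
    case True
    show ?thesis
      using spire_dist_tip[of u n s] that assms unfolding True by linarith
  next
    case False
    then show ?thesis
      using spire_dist_path[of u v n s] that assms by linarith
  qed
  have le: "?d u v \<le> n - 2" if "u \<in> {1..n}" "v \<in> {1..n}" for u v
    using ordered[of u v] ordered[of v u] that graph_dist_commute[of _ u v]
    by (cases u v rule: linorder_cases) auto
  have eq: "{?d u v | u v. u \<in> {1..n} \<and> v \<in> {1..n}} = case_prod ?d ` ({1..n} \<times> {1..n})"
    by fast
  have "1 \<in> {1..n}"
    using assms by auto
  then show ?thesis
    unfolding diam_def spire_verts_def eq
    by (subst Max_le_iff) (use le in auto)
qed

text \<open>Labels are indexed by \<^typ>\<open>int\<close> so that the formulas below involve no truncated subtraction.\<close>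

lemma rn_spire_le:
  fixes c :: "int \<Rightarrow> int"
  assumes s: "2 \<le> s" "s \<le> n - 2"
    and range: "\<And>i. 1 \<le> i \<Longrightarrow> i \<le> int n \<Longrightarrow> 1 \<le> c i \<and> c i \<le> B"
    and path: "\<And>i j. 1 \<le> i \<Longrightarrow> i < j \<Longrightarrow> j < int n \<Longrightarrow> int n - 1 \<le> \<bar>c i - c j\<bar> + (j - i)"
    and tip: "\<And>i. 1 \<le> i \<Longrightarrow> i < int n \<Longrightarrow> int n - 1 \<le> \<bar>c i - c (int n)\<bar> + \<bar>int s - i\<bar> + 1"
  shows "int (rn_spire n s) \<le> B"
proof -
  define l where "l = (\<lambda>v. nat (c (int v)))"
  let ?d = "\<lambda>u v. int (graph_dist (spire_edges n s) u v)"
  have l: "int (l v) = c (int v)" "0 < l v" "int (l v) \<le> B" if "v \<in> {1..n}" for v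
    using range[of "int v"] that by (auto simp: l_def)
  have ordered: "int n - 1 \<le> ?d u v + \<bar>c (int u) - c (int v)\<bar>"
    if "1 \<le> u" "u < v" "v \<le> n" for u v
  proof (cases "v = n")
    case True
    show ?thesis
      using spire_dist_tip[of u n s] tip[of "int u"] that s unfolding True by linarith
  next
    case False
    then show ?thesis
      using spire_dist_path[of u v n s] path[of "int u" "int v"] that s by linarith
  qed
  have "int n - 1 \<le> ?d u v + \<bar>int (l u) - int (l v)\<bar>"
    if "u \<in> {1..n}" "v \<in> {1..n}" "u \<noteq> v" for u v
    using ordered[of u v] ordered[of v u] that l(1) graph_dist_commute[of _ u v]
    by (cases u v rule: linorder_cases) (auto simp: abs_minus_commute)
  \<comment> \<open>An upper bound on the diameter suffices: separation \<open>n - 1\<close> then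
    covers the radio condition.\<close>
  moreover have "int (diam (spire_verts n) (spire_edges n s)) + 1 \<le> int n - 1"
    using spire_diam_le[OF s] s by linarith
  ultimately have "radio_labeling (spire_verts n) (spire_edges n s) l"
    using l(2) unfolding radio_labeling_def spire_verts_def by (meson order_trans)
  then have "rn_spire n s \<le> label_span (spire_verts n) l"
    unfolding rn_spire_def radio_number_def by (intro Least_le) auto
  also have "int \<dots> \<le> B"
  proof -
    have "Max (l ` {1..n}) \<in> l ` {1..n}"
      using s by (intro Max_in) auto
    then show ?thesis
      using l(3) by (auto simp: label_span_def spire_verts_def)
  qed
  finally show ?thesis
    by simp
qed

section \<open>Explicit labelings for the four cases\<close>

text \<open>Separates the cases of one step and of at least two, after which products can be treated as
  opaque and the verification of the labelings is linear.\<close>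

lemma mult_gap:
  fixes D a b :: int
  assumes "0 \<le> D"
  shows "a = b \<or> (b = a + 1 \<and> D * b = D * a + D) \<or> (a + 2 \<le> b \<and> D * a + 2 * D \<le> D * b)
    \<or> (a = b + 1 \<and> D * a = D * b + D) \<or> (b + 2 \<le> a \<and> D * b + 2 * D \<le> D * a)"
proof -
  have up: "D * x + 2 * D \<le> D * y" if "x + 2 \<le> y" for x y
    using mult_left_mono[OF that assms] by (simp add: algebra_simps)
  consider "a = b" | "b = a + 1" | "a = b + 1" | "a + 2 \<le> b" | "b + 2 \<le> a"
    by linarith
  then show ?thesis
    by cases (use up in \<open>simp_all add: distrib_left\<close>)
qed

text \<open>Order of increasing labels: \<open>r\<^sub>0\<close>, then \<open>l\<^sub>k\<^sub>-\<^sub>1\<^sub>-\<^sub>j\<close>, \<open>r\<^sub>j\<^sub>+\<^sub>1\<close> for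
  \<open>j = 0, \<dots>, k - 2\<close>, and the tip last.\<close>

lemma rn_spire_even_middle:
  assumes "2 \<le> k"
  shows "int (rn_spire (2 * k) k) \<le> 2 * int k ^ 2 - 2 * int k + 1"
proof -
  define K where "K = int k"
  define P where "P = (\<lambda>a. (2 * K - 1) * a)"
  define c where "c = (\<lambda>i. if i = 2 * K then P (K - 1) + K else
    if i < K then P (i - 1) + K + 1 else P (i - K) + 1)"
  have K: "2 \<le> K"
    using assms by (simp add: K_def)
  have n: "int (2 * k) = 2 * K"
    by (simp add: K_def)
  have mono: "P a \<le> P b" if "a \<le> b" for a b
    using that K by (simp add: P_def mult_left_mono)
  note gap = mult_gap[of "2 * K - 1", folded P_def]
  have P0: "P 0 = 0"
    by (simp add: P_def)
  show ?thesis
  proof (rule rn_spire_le[where c = c])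
    fix i assume "1 \<le> i" "i \<le> int (2 * k)"
    moreover have "P (K - 1) + K = 2 * K ^ 2 - 2 * K + 1"
      by (simp add: P_def power2_eq_square algebra_simps)
    ultimately show "1 \<le> c i \<and> c i \<le> 2 * int k ^ 2 - 2 * int k + 1"
      using K P0 mono[of 0 "i - 1"] mono[of 0 "i - K"] mono[of 0 "K - 1"] gap[of "i - 1" "K - 1"] mono[of "i - K" "K - 1"]
      unfolding c_def n K_def[symmetric] by (smt (verit))
  next
    fix i j assume "1 \<le> i" "i < j" "j < int (2 * k)"
    then show "int (2 * k) - 1 \<le> \<bar>c i - c j\<bar> + (j - i)"
      using K P0 gap[of "i - 1" "j - 1"] gap[of "i - K" "j - K"] gap[of "i - 1" "j - K"]
      unfolding c_def n K_def[symmetric] by (smt (verit))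
  next
    fix i assume "1 \<le> i" "i < int (2 * k)"
    then show "int (2 * k) - 1 \<le> \<bar>c i - c (int (2 * k))\<bar> + \<bar>int k - i\<bar> + 1"
      using K P0 gap[of "i - 1" "K - 1"] gap[of "i - K" "K - 1"]
      unfolding c_def n K_def[symmetric] by (smt (verit))
  qed (use assms in auto)
qed

text \<open>Order of increasing labels: \<open>r\<^sub>0\<close>, \<open>l\<^sub>k\<^sub>-\<^sub>1\<close>, \<open>r\<^sub>k\<^sub>-\<^sub>2\<close>, the tip, then \<open>r\<^sub>j\<close>, \<open>l\<^sub>k\<^sub>-\<^sub>1\<^sub>-\<^sub>j\<close> for
  \<open>j = 1, \<dots>, k - 3\<close>, then \<open>r\<^sub>k\<^sub>-\<^sub>1\<close> (with one extra unit before it), \<open>l\<^sub>1\<close>.\<close>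

lemma rn_spire_even_pred_middle:
  assumes "3 \<le> k"
  shows "int (rn_spire (2 * k) (k - 1)) \<le> 2 * int k ^ 2 - 2 * int k"
proof -
  define K where "K = int k"
  define P where "P = (\<lambda>a. (2 * K - 1) * a)"
  \<comment> \<open>For \<open>k\<close> \<ge> 4 the extra unit brings the adjacent vertices
    \<open>l\<^sub>2\<close>, \<open>l\<^sub>1\<close> to label difference
    \<open>2 * k - 2\<close>.\<close>
  define c where "c = (\<lambda>i. if i = 2 * K then 2 * K + 2 else if i = K then 1
    else if i = 1 then K + 1 else if i = 2 * K - 2 then K + 3
    else if i = 2 * K - 1 then P (K - 4) + 6 * K - 3 else if i = K - 1 then P (K - 4) + 7 * K - 4
    else if i < K then P (i - 2) + 5 * K - 2 else P (i - K - 1) + 4 * K - 2)"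
  have K: "3 \<le> K"
    using assms by (simp add: K_def)
  have n: "int (2 * k) = 2 * K"
    by (simp add: K_def)
  have s: "int (k - 1) = K - 1"
    using assms by (simp add: K_def)
  \<comment> \<open>For \<open>k = 3\<close> there are no repeated blocks, and
    \<open>P (K - 4)\<close> is \<open>P (- 1)\<close>.\<close>
  have P0: "P 0 = 0" and P1: "P (- 1) = - (2 * K - 1)"
    by (simp_all add: P_def)
  have mono: "P a \<le> P b" if "a \<le> b" for a b
    using that K by (simp add: P_def mult_left_mono)
  note gap = mult_gap[of "2 * K - 1", folded P_def]
  have top: "P (K - 4) + 7 * K - 4 = 2 * K ^ 2 - 2 * K"
    by (simp add: P_def power2_eq_square algebra_simps)
  have cases: "x = 1 \<and> c x = K + 1 \<or> 2 \<le> x \<and> x \<le> K - 2 \<and> c x = P (x - 2) + 5 * K - 2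
      \<or> x = K - 1 \<and> c x = P (K - 4) + 7 * K - 4 \<or> x = K \<and> c x = 1
      \<or> K + 1 \<le> x \<and> x \<le> 2 * K - 3 \<and> c x = P (x - K - 1) + 4 * K - 2
      \<or> x = 2 * K - 2 \<and> c x = K + 3 \<or> x = 2 * K - 1 \<and> c x = P (K - 4) + 6 * K - 3"
    if "1 \<le> x" "x < 2 * K" for x
    using that K by (auto simp: c_def)
  show ?thesis
  proof (rule rn_spire_le[where c = c])
    fix i assume "1 \<le> i" "i \<le> int (2 * k)"
    then show "1 \<le> c i \<and> c i \<le> 2 * int k ^ 2 - 2 * int k"
      using K P0 P1 top mono[of 0 "i - 2"] mono[of 0 "i - K - 1"] mono[of "i - 2" "K - 4"]
        mono[of "i - K - 1" "K - 4"] mono[of "- 1" "K - 4"]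
      unfolding c_def n K_def[symmetric] by (smt (verit))
  next
    fix i j assume "1 \<le> i" "i < j" "j < int (2 * k)"
    then show "int (2 * k) - 1 \<le> \<bar>c i - c j\<bar> + (j - i)"
      using cases[of i] cases[of j] K P0 P1 mono[of "- 1" "K - 4"]
        gap[of "i - 2" "j - 2"] gap[of "i - K - 1" "j - K - 1"] gap[of "i - 2" "j - K - 1"]
        mono[of 0 "i - 2"] mono[of 0 "i - K - 1"] mono[of 0 "j - 2"] mono[of 0 "j - K - 1"]
        gap[of "i - 2" "K - 4"] gap[of "i - K - 1" "K - 4"] gap[of "j - 2" "K - 4"]
        gap[of "j - K - 1" "K - 4"]
      unfolding n by (smt (verit))
  next
    fix i assume "1 \<le> i" "i < int (2 * k)"
    then show "int (2 * k) - 1 \<le> \<bar>c i - c (int (2 * k))\<bar> + \<bar>int (k - 1) - i\<bar> + 1"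
      using K P0 P1 mono[of 0 "i - 2"] mono[of 0 "i - K - 1"] mono[of "- 1" "K - 4"]
      unfolding c_def n s K_def[symmetric] by (smt (verit))
  qed (use assms in auto)
qed

text \<open>Order of increasing labels: \<open>r\<^sub>0\<close>, \<open>l\<^sub>k\<^sub>-\<^sub>1\<close>, \<open>r\<^sub>k\<^sub>-\<^sub>2\<close>, \<open>l\<^sub>1\<close>, \<open>r\<^sub>k\<^sub>-\<^sub>1\<close>, the tip (with one extra unit before
  it), then \<open>r\<^sub>j\<close>, \<open>l\<^sub>k\<^sub>-\<^sub>1\<^sub>-\<^sub>j\<close> for \<open>j = 1, \<dots>, k - 3\<close>.\<close>

lemma rn_spire_even_left:
  assumes "2 \<le> s" "s + 2 \<le> k"
  shows "int (rn_spire (2 * k) s) \<le> 2 * int k ^ 2 - 4 * int k + 2 * int s + 3"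
proof -
  define K where "K = int k"
  define S where "S = int s"
  define P where "P = (\<lambda>a. (2 * K - 1) * a)"
  \<comment> \<open>The extra unit is due to \<open>l\<^sub>1\<close>: it lies at distance
    \<open>k - s\<close> from the tip, so their labels must differ by
    \<open>k + s - 1\<close>.\<close>
  define c where "c = (\<lambda>i. if i = 2 * K then 3 * K + S + 2 else if i = K then 1
    else if i = 1 then K + 1 else if i = 2 * K - 2 then K + 3
    else if i = 2 * K - 1 then 3 * K + 2 else if i = K - 1 then 2 * K + 3
    else if i < K then P (i - 2) + 5 * K + 2 * S - 1 else P (i - K - 1) + 4 * K + 2 * S - 1)"
  have K: "2 \<le> S" "S + 2 \<le> K"
    using assms by (simp_all add: K_def S_def)
  have n: "int (2 * k) = 2 * K"
    by (simp add: K_def)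
  have P0: "P 0 = 0"
    by (simp add: P_def)
  have mono: "P a \<le> P b" if "a \<le> b" for a b
    using that K by (simp add: P_def mult_left_mono)
  note gap = mult_gap[of "2 * K - 1", folded P_def]
  have top: "P (K - 4) + 5 * K + 2 * S - 1 = 2 * K ^ 2 - 4 * K + 2 * S + 3"
    by (simp add: P_def power2_eq_square algebra_simps)
  show ?thesis
  proof (rule rn_spire_le[where c = c])
    fix i assume "1 \<le> i" "i \<le> int (2 * k)"
    then show "1 \<le> c i \<and> c i \<le> 2 * int k ^ 2 - 4 * int k + 2 * int s + 3"
      using K P0 top mono[of 0 "i - 2"] mono[of 0 "i - K - 1"] mono[of "i - 2" "K - 4"]
        mono[of "i - K - 1" "K - 4"] mono[of 0 "K - 4"]
      unfolding c_def n K_def[symmetric] S_def[symmetric] by (smt (verit))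
  next
    fix i j assume "1 \<le> i" "i < j" "j < int (2 * k)"
    then show "int (2 * k) - 1 \<le> \<bar>c i - c j\<bar> + (j - i)"
      using K P0 gap[of "i - 2" "j - 2"] gap[of "i - K - 1" "j - K - 1"] gap[of "i - 2" "j - K - 1"]
        gap[of 0 "i - 2"] gap[of 0 "i - K - 1"] gap[of 0 "j - 2"] gap[of 0 "j - K - 1"]
      unfolding c_def n K_def[symmetric] by (smt (verit))
  next
    fix i assume "1 \<le> i" "i < int (2 * k)"
    then show "int (2 * k) - 1 \<le> \<bar>c i - c (int (2 * k))\<bar> + \<bar>int s - i\<bar> + 1"
      using K P0 mono[of 0 "i - 2"] mono[of 0 "i - K - 1"]
      unfolding c_def n K_def[symmetric] S_def[symmetric] by (smt (verit))
  qed (use assms in auto)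
qed

text \<open>Order of increasing labels: \<open>l\<^sub>0\<close>, \<open>r\<^sub>k\<^sub>-\<^sub>1\<close>, then \<open>l\<^sub>j\<close>, \<open>r\<^sub>k\<^sub>-\<^sub>1\<^sub>-\<^sub>j\<close> for \<open>j = 2, \<dots>, k - 1\<close>, then the tip,
  \<open>r\<^sub>k\<^sub>-\<^sub>2\<close>, \<open>l\<^sub>1\<close>.\<close>

lemma rn_spire_odd:
  assumes "2 \<le> s" "s \<le> k"
  shows "int (rn_spire (2 * k + 1) s) \<le> 2 * int k ^ 2 - 2 * int k + 2 * int s"
proof -
  define K where "K = int k"
  define S where "S = int s"
  define P where "P = (\<lambda>a. (2 * K - 1) * a)"
  \<comment> \<open>After the tip the labels grow by \<open>S\<close>, then \<open>K\<close>:
    \<open>r\<^sub>k\<^sub>-\<^sub>2\<close> is at distance \<open>2 * k - s\<close> from the tip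
    and \<open>k\<close> from \<open>l\<^sub>1\<close>.\<close>
  define c where "c = (\<lambda>i. if i = 2 * K + 1 then P (K - 2) + 2 * K + S - 2 else if i = K then 1
    else if i = 2 * K then K + 1 else if i = 2 * K - 1 then P (K - 2) + 2 * K + 2 * S - 2
    else if i = K - 1 then P (K - 2) + 3 * K + 2 * S - 2
    else if i < K then P (K - i - 1) else P (2 * K - i - 1) + K)"
  have K: "2 \<le> S" "S \<le> K"
    using assms by (simp_all add: K_def S_def)
  have n: "int (2 * k + 1) = 2 * K + 1"
    by (simp add: K_def)
  have P0: "P 0 = 0" and P1: "P 1 = 2 * K - 1"
    by (simp_all add: P_def)
  have mono: "P a \<le> P b" if "a \<le> b" for a b
    using that K by (simp add: P_def mult_left_mono)
  note gap = mult_gap[of "2 * K - 1", folded P_def]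
  have top: "P (K - 2) + 3 * K + 2 * S - 2 = 2 * K ^ 2 - 2 * K + 2 * S"
    by (simp add: P_def power2_eq_square algebra_simps)
  have cases: "1 \<le> x \<and> x \<le> K - 2 \<and> c x = P (K - x - 1) \<or> x = K \<and> c x = 1
      \<or> x = K - 1 \<and> c x = P (K - 2) + 3 * K + 2 * S - 2
      \<or> K + 1 \<le> x \<and> x \<le> 2 * K - 2 \<and> c x = P (2 * K - x - 1) + K
      \<or> x = 2 * K - 1 \<and> c x = P (K - 2) + 2 * K + 2 * S - 2 \<or> x = 2 * K \<and> c x = K + 1"
    if "1 \<le> x" "x < 2 * K + 1" for x
    using that K by (auto simp: c_def)
  show ?thesis
  proof (rule rn_spire_le[where c = c])
    fix i assume "1 \<le> i" "i \<le> int (2 * k + 1)"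
    then show "1 \<le> c i \<and> c i \<le> 2 * int k ^ 2 - 2 * int k + 2 * int s"
      using K P0 P1 top mono[of 1 "K - i - 1"] mono[of 1 "2 * K - i - 1"] mono[of "K - i - 1" "K - 2"]
        mono[of "2 * K - i - 1" "K - 2"] mono[of 0 "K - 2"]
      unfolding c_def n K_def[symmetric] S_def[symmetric] by (smt (verit))
  next
    fix i j assume ij: "1 \<le> i" "i < j" "j < int (2 * k + 1)"
    then have "1 \<le> i" "i < 2 * K + 1" "1 \<le> j" "j < 2 * K + 1"
      using n by linarith+
    note cases[OF this(1,2)] cases[OF this(3,4)]
    then show "int (2 * k + 1) - 1 \<le> \<bar>c i - c j\<bar> + (j - i)"
      by (elim disjE; use ij K P0 P1 mono[of 0 "K - 2"]
        gap[of "K - i - 1" "K - j - 1"] gap[of "2 * K - i - 1" "2 * K - j - 1"]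
        gap[of "K - i - 1" "2 * K - j - 1"]
        mono[of 1 "K - i - 1"] mono[of 1 "2 * K - i - 1"] mono[of 1 "K - j - 1"] mono[of 1 "2 * K - j - 1"]
        gap[of "K - i - 1" "K - 2"] gap[of "2 * K - i - 1" "K - 2"] gap[of "K - j - 1" "K - 2"]
        gap[of "2 * K - j - 1" "K - 2"] n in \<open>smt (verit)\<close>)
  next
    fix i assume "1 \<le> i" "i < int (2 * k + 1)"
    then show "int (2 * k + 1) - 1 \<le> \<bar>c i - c (int (2 * k + 1))\<bar> + \<bar>int s - i\<bar> + 1"
      using K P0 P1 mono[of "K - i - 1" "K - 2"] mono[of "2 * K - i - 1" "K - 2"] mono[of 0 "K - 2"]
      unfolding c_def n K_def[symmetric] S_def[symmetric] by (smt (verit))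
  qed (use assms in auto)
qed

theorem mainTheorem2:
  fixes n s k :: nat
  assumes "n \<ge> 4" and "2 \<le> s" and "s \<le> n div 2"
  shows "(n = 2 * k \<and> 2 \<le> s \<and> int s \<le> int k - 2 \<longrightarrow>
            int (rn_spire n s) \<le> 2 * int k ^ 2 - 4 * int k + 2 * int s + 3) \<and>
         (n = 2 * k \<and> int s = int k - 1 \<longrightarrow>
            int (rn_spire n s) \<le> 2 * int k ^ 2 - 2 * int k) \<and>
         (n = 2 * k \<and> s = k \<longrightarrow>
            int (rn_spire n s) \<le> 2 * int k ^ 2 - 2 * int k + 1) \<and>
         (n = 2 * k + 1 \<longrightarrow>
            int (rn_spire n s) \<le> 2 * int k ^ 2 - 2 * int k + 2 * int s)"
proof (intro conjI impI)
  assume "n = 2 * k \<and> 2 \<le> s \<and> int s \<le> int k - 2"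
  then show "int (rn_spire n s) \<le> 2 * int k ^ 2 - 4 * int k + 2 * int s + 3"
    using rn_spire_even_left[of s k] assms by simp
next
  assume "n = 2 * k \<and> int s = int k - 1"
  moreover from this have "s = k - 1" "3 \<le> k"
    using assms by linarith+
  ultimately show "int (rn_spire n s) \<le> 2 * int k ^ 2 - 2 * int k"
    using rn_spire_even_pred_middle by simp
next
  assume "n = 2 * k \<and> s = k"
  then show "int (rn_spire n s) \<le> 2 * int k ^ 2 - 2 * int k + 1"
    using rn_spire_even_middle assms by simp
next
  assume "n = 2 * k + 1"
  then show "int (rn_spire n s) \<le> 2 * int k ^ 2 - 2 * int k + 2 * int s"
    using rn_spire_odd assms by simp
qed

end
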